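(* Let $T$ be a nontrivial finite metric tree of length $L=|T|$ and metric radius $\rho$, and let $0<r\le L-\rho$. (i) There is a $0$-good cover of $T$ using at most $\lfloor L/r\rfloor$ balls. (ii) For every $p>0$, there is a $0$-good cover $(r_1,\dots,r_m)$ of $T$ satisfying $\sum_{i=1}^m r_i^p\le \frac{L r^{p-1}}{p+1}$. In particular, one may require $\sum_i r_i\le L/2$. (iii) For every fixed $t\in[0,r]$, there is a $0$-good cover $(r_1,\dots,r_m)$ of $T$, depending on $t$, such that $|\{i:r_i\ge t\}|\le\lfloor L(r-t)/r^2\rfloor$.
   Context: A finite metric tree is the metric realization of a finite combinatorial tree whose edges have positive lengths; it is nontrivial if it is not a single point. $|T|$ is the total edge length, $d_T$ the path metric, $B_T(v,s)=\{x\in T: d_T(x,v)\le s\}$, and the metric radius is $\min_{v\in T}\max_{x\in T}d_T(v,x)$. For $m\ge1$, a tuple $(r_1,\dots,r_m)\in\mathbb R_{\ge0}^m$ is a cover of $T$ (using $m$ balls) if there are $v_1,\dots,v_m\in T$ with $T\subseteq\bigcup_i B_T(v_i,r_i)$; it is $0$-good if $\sum_i r_i\le|T|$. *)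

theory Defs
  imports Complex_Main
begin

record 'a weighted_graph =
  nodes :: "'a set"
  edges :: "'a set set"
  edge_length :: "'a set \<Rightarrow> real"

definition graph_connected :: "('a, 'b) weighted_graph_scheme \<Rightarrow> bool" where
  "graph_connected T \<longleftrightarrow>
     (\<forall>u\<in>nodes T. \<forall>v\<in>nodes T. (u, v) \<in> {(a, b). {a, b} \<in> edges T}\<^sup>*)"

definition graph_cycle :: "('a, 'b) weighted_graph_scheme \<Rightarrow> 'a list \<Rightarrow> bool" where
  "graph_cycle T vs \<longleftrightarrow> 3 \<le> length vs \<and> distinct vs \<and>
     (\<forall>i<length vs. {vs ! i, vs ! (Suc i mod length vs)} \<in> edges T)"

definition finite_metric_tree :: "('a, 'b) weighted_graph_scheme \<Rightarrow> bool" where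
  "finite_metric_tree T \<longleftrightarrow>
     finite (nodes T) \<and> nodes T \<noteq> {} \<and>
     (\<forall>e\<in>edges T. e \<subseteq> nodes T \<and> card e = 2) \<and>
     graph_connected T \<and> (\<nexists>vs. graph_cycle T vs) \<and>
     (\<forall>e\<in>edges T. 0 < edge_length T e)"

text \<open>
  The points of the realization are given by barycentric coordinates with respect to the
  nodes: a node is the indicator function of its singleton, and the point of an edge
  \<open>{u, v}\<close> at distance \<open>s\<close> times the edge length from \<open>u\<close> has coordinate \<open>1 - s\<close> at \<open>u\<close>,
  \<open>s\<close> at \<open>v\<close> and \<open>0\<close> elsewhere. Thus edges are glued exactly at common end nodes. The
  singleton cells matter only for the one-node tree, which has no edges.
\<close>

definition cell_points :: "'a set \<Rightarrow> ('a \<Rightarrow> real) set" where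
  "cell_points c = {x. (\<forall>u. 0 \<le> x u) \<and> (\<forall>u. u \<notin> c \<longrightarrow> x u = 0) \<and> (\<Sum>u\<in>c. x u) = 1}"

definition tree_points :: "('a, 'b) weighted_graph_scheme \<Rightarrow> ('a \<Rightarrow> real) set" where
  "tree_points T = (\<Union>e\<in>edges T. cell_points e) \<union> (\<Union>v\<in>nodes T. cell_points {v})"

definition nontrivial_tree :: "('a, 'b) weighted_graph_scheme \<Rightarrow> bool" where
  "nontrivial_tree T \<longleftrightarrow> \<not> (\<exists>x. tree_points T = {x})"

definition total_length :: "('a, 'b) weighted_graph_scheme \<Rightarrow> real" where
  "total_length T = (\<Sum>e\<in>edges T. edge_length T e)"

text \<open>
  On an edge \<open>{u, v}\<close> the coordinates of a point sum to \<open>1\<close>, so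
  \<open>\<bar>x u - y u\<bar> = \<bar>x v - y v\<bar>\<close>; halving the sum over both ends makes the formula symmetric.
\<close>

definition segment_length ::
    "('a, 'b) weighted_graph_scheme \<Rightarrow> 'a set \<Rightarrow> ('a \<Rightarrow> real) \<Rightarrow> ('a \<Rightarrow> real) \<Rightarrow> real" where
  "segment_length T e x y = edge_length T e * ((\<Sum>u\<in>e. \<bar>x u - y u\<bar>) / 2)"

text \<open>
  \<open>pl_path T x y l\<close>: there is a piecewise linear path of length \<open>l\<close> from \<open>x\<close> to \<open>y\<close>, each of
  whose finitely many pieces is a segment in a closed edge.
\<close>

inductive pl_path ::
    "('a, 'b) weighted_graph_scheme \<Rightarrow> ('a \<Rightarrow> real) \<Rightarrow> ('a \<Rightarrow> real) \<Rightarrow> real \<Rightarrow> bool"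
  for T where
  stay: "x \<in> tree_points T \<Longrightarrow> pl_path T x x 0"
| step: "\<lbrakk>e \<in> edges T; x \<in> cell_points e; y \<in> cell_points e; pl_path T y z l\<rbrakk>
    \<Longrightarrow> pl_path T x z (segment_length T e x y + l)"

definition tree_dist ::
    "('a, 'b) weighted_graph_scheme \<Rightarrow> ('a \<Rightarrow> real) \<Rightarrow> ('a \<Rightarrow> real) \<Rightarrow> real" where
  "tree_dist T x y = Inf {l. pl_path T x y l}"

definition tree_ball ::
    "('a, 'b) weighted_graph_scheme \<Rightarrow> ('a \<Rightarrow> real) \<Rightarrow> real \<Rightarrow> ('a \<Rightarrow> real) set" where
  "tree_ball T v s = {x \<in> tree_points T. tree_dist T x v \<le> s}"

text \<open>Both extrema are attained, since a finite metric tree is compact.\<close>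

definition metric_radius :: "('a, 'b) weighted_graph_scheme \<Rightarrow> real" where
  "metric_radius T = (INF v\<in>tree_points T. SUP x\<in>tree_points T. tree_dist T v x)"

definition is_cover :: "('a, 'b) weighted_graph_scheme \<Rightarrow> real list \<Rightarrow> bool" where
  "is_cover T rs \<longleftrightarrow> 1 \<le> length rs \<and> (\<forall>i<length rs. 0 \<le> rs ! i) \<and>
     (\<exists>v. (\<forall>i<length rs. v i \<in> tree_points T) \<and>
          tree_points T \<subseteq> (\<Union>i<length rs. tree_ball T (v i) (rs ! i)))"

definition zero_good_cover :: "('a, 'b) weighted_graph_scheme \<Rightarrow> real list \<Rightarrow> bool" where
  "zero_good_cover T rs \<longleftrightarrow> is_cover T rs \<and> (\<Sum>i<length rs. rs ! i) \<le> total_length T"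

end

theory Submission
  imports Defs "HOL-Analysis.Convex" "HOL-Library.Indicator_Function"
begin

text \<open>
  Only two kinds of covers occur: one ball, and very many small balls of equal size on each edge.
  Write \<open>L\<close> for the total length and \<open>\<rho>\<close> for the metric radius.

  A single ball. Some point lies within \<open>L / 2\<close> of all others (\<open>exists_centre\<close>): the tree is built
  up edge by edge, and each time an edge is attached, the centre moves towards it by half of its
  length. So one ball of radius \<open>L / 2\<close> is a cover, which settles the number of balls, since
  \<open>r \<le> L\<close>, as well as the bound \<open>L / 2\<close> on the sum of the radii; moreover \<open>\<rho> \<le> L / 2\<close>. One ball of
  radius just above \<open>\<rho>\<close> settles the power sums for \<open>p < 1\<close> (\<open>power_sum_less_one\<close>). Up to that
  small excess, the claim is that \<open>\<rho>\<^sup>p\<close> is less than \<open>L r\<^sup>p\<^sup>-\<^sup>1 / (p + 1)\<close>; the weighted inequality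
  between the arithmetic and the geometric mean makes it linear in \<open>\<rho>\<close> and \<open>r\<close>, and then
  \<open>r \<le> L - \<rho>\<close> and \<open>\<rho> \<le> L / 2\<close> suffice.

  Many small balls. Pieces of edges are covered by balls around their midpoints, so there are
  covers with arbitrarily small radii whose sum is always \<open>L / 2\<close> (\<open>exists_fine_cover\<close>). For
  \<open>p \<ge> 1\<close> small radii make the power sum small (\<open>power_sum_ge_one\<close>), and for \<open>t > 0\<close> a cover all of
  whose radii are below \<open>t\<close> has nothing to count; for \<open>t = 0\<close> all balls count, and the single
  ball of radius \<open>L / 2\<close> serves again.
\<close>

section \<open>Points on a cell\<close>

text \<open>
  The parametrization of an edge by \<open>[0, 1]\<close>: turns statements about barycentric coordinates
  into statements about one real parameter.
\<close>

definition edge_point :: "'a \<Rightarrow> 'a \<Rightarrow> real \<Rightarrow> 'a \<Rightarrow> real" where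
  "edge_point u w s = (\<lambda>x. if x = u then 1 - s else if x = w then s else 0)"

lemma edge_point_in_cell:
  assumes "u \<noteq> w" "0 \<le> s" "s \<le> 1"
  shows "edge_point u w s \<in> cell_points {u, w}"
  using assms by (auto simp: cell_points_def edge_point_def)

lemma cell_points_eq_edge_point:
  assumes "u \<noteq> w" "x \<in> cell_points {u, w}"
  obtains s where "0 \<le> s" "s \<le> 1" "x = edge_point u w s"
proof
  have x: "\<And>v. 0 \<le> x v" "\<And>v. v \<notin> {u, w} \<Longrightarrow> x v = 0" "x u + x w = 1"
    using assms by (auto simp: cell_points_def)
  show "0 \<le> x w" "x w \<le> 1" using x(1)[of u] x(1)[of w] x(3) by auto
  show "x = edge_point u w (x w)" using x assms(1) by (auto simp: edge_point_def fun_eq_iff)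
qed

lemma segment_length_edge_point:
  assumes "u \<noteq> w"
  shows "segment_length T {u, w} (edge_point u w s) (edge_point u w t)
    = edge_length T {u, w} * \<bar>s - t\<bar>"
  using assms by (simp add: segment_length_def edge_point_def abs_minus_commute)

lemma segment_length_commute: "segment_length T e x y = segment_length T e y x"
  by (simp add: segment_length_def abs_minus_commute)

lemma cell_points_singleton: "cell_points {v} = {indicator {v}}"
proof (intro set_eqI iffI)
  fix x :: "'a \<Rightarrow> real" assume "x \<in> cell_points {v}"
  then show "x \<in> {indicator {v}}"
    by (auto simp: cell_points_def fun_eq_iff indicator_def)
qed (auto simp: cell_points_def)

lemma indicator_in_cell:
  assumes "finite e" "v \<in> e"
  shows "indicator {v} \<in> cell_points e"
  using assms by (auto simp: cell_points_def indicator_def sum.delta)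

lemma cell_points_convex:
  assumes "x \<in> cell_points e" "y \<in> cell_points e" "0 \<le> s" "s \<le> 1"
  shows "(\<lambda>u. (1 - s) * x u + s * y u) \<in> cell_points e"
  using assms by (auto simp: cell_points_def sum.distrib simp flip: sum_distrib_left)

section \<open>Paths and distances\<close>

context
  fixes T :: "('a, 'b) weighted_graph_scheme"
  assumes tree: "finite_metric_tree T"
begin

lemma finite_nodes: "finite (nodes T)"
  and edge_subset: "e \<in> edges T \<Longrightarrow> e \<subseteq> nodes T"
  and edge_card: "e \<in> edges T \<Longrightarrow> card e = 2"
  and edge_length_pos: "e \<in> edges T \<Longrightarrow> 0 < edge_length T e"
  using tree by (auto simp: finite_metric_tree_def)

lemma finite_edges: "finite (edges T)"
  using finite_subset[of "edges T" "Pow (nodes T)"] finite_nodes edge_subset by auto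

lemma finite_edge: "e \<in> edges T \<Longrightarrow> finite e"
  using edge_card by (metis card.infinite zero_neq_numeral)

lemma cell_subset_tree_points: "e \<in> edges T \<Longrightarrow> cell_points e \<subseteq> tree_points T"
  by (auto simp: tree_points_def)

lemma segment_length_nonneg: "e \<in> edges T \<Longrightarrow> 0 \<le> segment_length T e x y"
  using edge_length_pos[of e] by (simp add: segment_length_def sum_nonneg)

lemma pl_path_nonneg: "pl_path T x y l \<Longrightarrow> 0 \<le> l"
  by (induction rule: pl_path.induct) (auto simp: segment_length_nonneg)

lemma pl_path_points:
  "pl_path T x y l \<Longrightarrow> x \<in> tree_points T \<and> y \<in> tree_points T"
  by (induction rule: pl_path.induct) (use cell_subset_tree_points in auto)

lemma pl_path_segment:
  assumes "e \<in> edges T" "x \<in> cell_points e" "y \<in> cell_points e"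
  shows "pl_path T x y (segment_length T e x y)"
  using pl_path.step[OF assms pl_path.stay] assms cell_subset_tree_points by auto

lemma pl_path_edge_point:
  assumes "{u, w} \<in> edges T" "u \<noteq> w" "s \<in> {0..1}" "t \<in> {0..1}"
  shows "pl_path T (edge_point u w s) (edge_point u w t) (edge_length T {u, w} * \<bar>s - t\<bar>)"
  using pl_path_segment[OF assms(1) edge_point_in_cell edge_point_in_cell] assms
  by (simp add: segment_length_edge_point)

lemma pl_path_trans: "pl_path T x y l \<Longrightarrow> pl_path T y z m \<Longrightarrow> pl_path T x z (l + m)"
proof (induction rule: pl_path.induct)
  case (step e x y z' l)
  then show ?case
    using pl_path.step[of e T x y z "l + m"] by (simp add: add.assoc)
qed simp

lemma pl_path_sym: "pl_path T x y l \<Longrightarrow> pl_path T y x l"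
proof (induction rule: pl_path.induct)
  case (step e x y z l)
  then have "pl_path T z x (l + segment_length T e y x)"
    using pl_path_trans pl_path_segment by blast
  then show ?case by (simp add: segment_length_commute add.commute)
qed (rule pl_path.stay)

lemma segment_split:
  assumes "e \<in> edges T" "x \<in> cell_points e" "y \<in> cell_points e"
    and "0 \<le> a" "a \<le> segment_length T e x y"
  obtains z where "z \<in> cell_points e" "segment_length T e x z = a"
    "segment_length T e z y = segment_length T e x y - a"
proof -
  define m where "m = segment_length T e x y"
  \<comment> \<open>If the segment is degenerate, then \<open>s = 0\<close> because \<open>a = 0\<close> and division by zero gives zero.\<close>
  define s where "s = a / m"
  define z where "z = (\<lambda>u. (1 - s) * x u + s * y u)"
  have s: "0 \<le> s" "s \<le> 1" "s * m = a"
    using assms segment_length_nonneg[OF assms(1), of x y]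
    by (auto simp: s_def m_def divide_le_eq_1)
  have "\<bar>x u - z u\<bar> = s * \<bar>x u - y u\<bar>" for u
  proof -
    have "x u - z u = s * (x u - y u)" by (simp add: z_def algebra_simps)
    then show ?thesis using s by (simp add: abs_mult)
  qed
  then have xz: "segment_length T e x z = s * m"
    by (simp add: segment_length_def m_def flip: sum_distrib_left)
  have "\<bar>z u - y u\<bar> = (1 - s) * \<bar>x u - y u\<bar>" for u
  proof -
    have "z u - y u = (1 - s) * (x u - y u)" by (simp add: z_def algebra_simps)
    then show ?thesis using s by (simp add: abs_mult)
  qed
  then have zy: "segment_length T e z y = (1 - s) * m"
    by (simp add: segment_length_def m_def flip: sum_distrib_left)
  have "z \<in> cell_points e"
    unfolding z_def using assms s by (intro cell_points_convex) auto
  then show thesis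
    using that xz zy s by (auto simp: m_def algebra_simps)
qed

text \<open>
  Points can be moved along a path by any prescribed amount, so the realization behaves as a
  length space.
\<close>

lemma pl_path_split:
  assumes "pl_path T x z l" "0 \<le> a" "a \<le> l"
  shows "\<exists>y. pl_path T x y a \<and> pl_path T y z (l - a)"
  using assms
proof (induction arbitrary: a rule: pl_path.induct)
  case (stay x)
  then show ?case by (auto intro!: exI[of _ x] pl_path.stay)
next
  case (step e x y z l)
  let ?m = "segment_length T e x y"
  show ?case
  proof (cases "a \<le> ?m")
    case True
    then obtain v where v: "v \<in> cell_points e" "segment_length T e x v = a"
      "segment_length T e v y = ?m - a"
      using segment_split step by metis
    have "pl_path T x v a" using pl_path_segment[of e x v] step v by simp
    moreover have "pl_path T v z (?m - a + l)"
      using pl_path.step[OF step(1) v(1) step(3,4)] v by simp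
    ultimately show ?thesis by (auto simp: algebra_simps)
  next
    case False
    then obtain v where v: "pl_path T y v (a - ?m)" "pl_path T v z (l - (a - ?m))"
      using step.IH[of "a - ?m"] step.prems by auto
    have "pl_path T x v a" using pl_path.step[OF step(1-3) v(1)] by simp
    then show ?thesis using v by (auto simp: algebra_simps)
  qed
qed

lemma tree_dist_le: "pl_path T x y l \<Longrightarrow> tree_dist T x y \<le> l"
  unfolding tree_dist_def by (rule cInf_lower) (auto intro: bdd_belowI pl_path_nonneg)

lemma tree_dist_nonneg:
  assumes "pl_path T x y l"
  shows "0 \<le> tree_dist T x y"
  unfolding tree_dist_def using assms by (intro cInf_greatest) (auto intro: pl_path_nonneg)

lemma tree_dist_commute: "tree_dist T x y = tree_dist T y x"
proof -
  have "pl_path T x y = pl_path T y x" using pl_path_sym by blast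
  then show ?thesis by (simp add: tree_dist_def)
qed

section \<open>A centre at distance at most half the total length\<close>

text \<open>
  The inductive step of the construction of a centre. Glueing an edge of length \<open>\<ell>\<close> at \<open>u\<close> to a
  region within \<open>h\<close> of \<open>c\<close> allows the bound to grow by only \<open>\<ell> / 2\<close>, because the centre may
  follow the new edge: it is moved from \<open>c\<close> by \<open>\<ell> / 2\<close> towards \<open>u\<close>, and beyond \<open>u\<close> into the new
  edge if \<open>u\<close> is closer than that.
\<close>

lemma centre_extend:
  assumes e: "{u, w} \<in> edges T" "u \<noteq> w"
    and path: "pl_path T c (edge_point u w 0) d" and d: "d \<le> h"
  obtains c' where "pl_path T c c' (edge_length T {u, w} / 2)"
    "\<And>y. y \<in> cell_points {u, w} \<Longrightarrow> \<exists>l\<le>h + edge_length T {u, w} / 2. pl_path T c' y l"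
proof -
  define k where "k = edge_length T {u, w}"
  have k: "0 < k" using e edge_length_pos by (simp add: k_def)
  have d0: "0 \<le> d" using path pl_path_nonneg by auto
  show thesis
  proof (cases "k / 2 \<le> d")
    case True
    then obtain c' where c': "pl_path T c c' (k / 2)"
      "pl_path T c' (edge_point u w 0) (d - k / 2)"
      using pl_path_split[OF path, of "k / 2"] k by auto
    have "\<exists>l\<le>h + k / 2. pl_path T c' y l" if y: "y \<in> cell_points {u, w}" for y
    proof -
      obtain s where s: "0 \<le> s" "s \<le> 1" "y = edge_point u w s"
        using cell_points_eq_edge_point[OF e(2) y] .
      have "pl_path T c' y (d - k / 2 + k * s)"
        using pl_path_trans[OF c'(2) pl_path_edge_point[OF e, of 0 s]] s by (simp add: k_def)
      moreover have "k * s \<le> k" using s k by (simp add: mult_left_le)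
      ultimately show ?thesis using d by (intro exI[of _ "d - k / 2 + k * s"]) auto
    qed
    then show thesis using that c' by (simp add: k_def)
  next
    case False
    define s where "s = (k / 2 - d) / k"
    have s: "0 \<le> s" "s \<le> 1" "k * s = k / 2 - d" using False d0 k by (auto simp: s_def)
    define c' where "c' = edge_point u w s"
    have "pl_path T c c' (d + k * s)"
      using pl_path_trans[OF path pl_path_edge_point[OF e, of 0 s]] s by (simp add: k_def c'_def)
    then have "pl_path T c c' (k / 2)" using s by simp
    moreover have "\<exists>l\<le>h + k / 2. pl_path T c' y l" if y: "y \<in> cell_points {u, w}" for y
    proof -
      obtain t where t: "0 \<le> t" "t \<le> 1" "y = edge_point u w t"
        using cell_points_eq_edge_point[OF e(2) y] .
      have "pl_path T c' y (k * \<bar>s - t\<bar>)"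
        using pl_path_edge_point[OF e, of s t] s t by (simp add: k_def c'_def)
      moreover have "k * \<bar>s - t\<bar> \<le> h + k / 2"
      proof -
        have "k * \<bar>s - t\<bar> = \<bar>k * s - k * t\<bar>"
          using k by (simp add: abs_mult flip: right_diff_distrib)
        moreover have "0 \<le> k * t" "k * t \<le> k" using t k by (auto simp: mult_left_le)
        ultimately show ?thesis using s d d0 k by linarith
      qed
      ultimately show ?thesis by blast
    qed
    ultimately show thesis using that by (simp add: k_def)
  qed
qed

text \<open>
  Connectivity lets the edges be added one at a time so that each new one meets what has been
  reached so far.
\<close>

lemma exists_adjacent_edge:
  assumes F: "F \<subset> edges T" and v0: "v0 \<in> nodes T"
  obtains u w where "{u, w} \<in> edges T - F" "u \<noteq> w" "u \<in> insert v0 (\<Union>F)"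
proof -
  let ?N = "insert v0 (\<Union>F)"
  have "\<exists>e\<in>edges T - F. e \<inter> ?N \<noteq> {}"
  proof (rule ccontr)
    assume none: "\<not> (\<exists>e\<in>edges T - F. e \<inter> ?N \<noteq> {})"
    \<comment> \<open>Then the reached nodes are closed under adjacency, hence are all the nodes.\<close>
    have inF: "e \<in> F" if "e \<in> edges T" "y \<in> e" "y \<in> ?N" for e y
      using none that by (metis DiffI IntI empty_iff)
    have closed: "v \<in> ?N" if "(v0, v) \<in> {(a, b). {a, b} \<in> edges T}\<^sup>*" for v
      using that
    proof (induction rule: rtrancl_induct)
      case (step y z)
      then have "{y, z} \<in> F" using inF[of "{y, z}" y] by simp
      then show ?case by auto
    qed simp
    obtain e where e: "e \<in> edges T" "e \<notin> F" using F by auto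
    then have "e \<noteq> {}" using edge_card by fastforce
    then obtain v where v: "v \<in> e" by auto
    then have "v \<in> nodes T" using e edge_subset by auto
    then have "(v0, v) \<in> {(a, b). {a, b} \<in> edges T}\<^sup>*"
      using tree v0 unfolding finite_metric_tree_def graph_connected_def by simp
    then show False using inF[OF e(1) v closed] e(2) by simp
  qed
  then obtain e u where e: "e \<in> edges T - F" "u \<in> e" "u \<in> ?N" by auto
  then obtain a b where ab: "e = {a, b}" "a \<noteq> b" using edge_card by (metis DiffD1 card_2_iff)
  show thesis
  proof (cases "u = a")
    case True then show ?thesis using that e ab by blast
  next
    case False
    then have "u = b" using e ab by auto
    then show ?thesis using that[of b a] e ab by (simp add: insert_commute)
  qed
qed

lemma exists_centre_of_part:
  assumes v0: "v0 \<in> nodes T" and n: "n \<le> card (edges T)"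
  shows "\<exists>F c. F \<subseteq> edges T \<and> card F = n \<and>
    (\<forall>x\<in>insert (indicator {v0}) (\<Union>e\<in>F. cell_points e).
      \<exists>l\<le>(\<Sum>e\<in>F. edge_length T e) / 2. pl_path T c x l)"
  using n
proof (induction n)
  case 0
  have "indicator {v0} \<in> tree_points T"
    unfolding tree_points_def cell_points_singleton using v0 by blast
  then have "pl_path T (indicator {v0}) (indicator {v0}) 0" by (rule pl_path.stay)
  then show ?case by (intro exI[of _ "{}"] exI[of _ "indicator {v0}"]) auto
next
  case (Suc n)
  then obtain F c where F: "F \<subseteq> edges T" "card F = n"
    and c: "\<And>x. x \<in> insert (indicator {v0}) (\<Union>e\<in>F. cell_points e) \<Longrightarrow>
      \<exists>l\<le>(\<Sum>e\<in>F. edge_length T e) / 2. pl_path T c x l" by fastforce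
  have finF: "finite F" using F finite_edges finite_subset by auto
  have "F \<subset> edges T" using F Suc.prems by auto
  then obtain u w where uw: "{u, w} \<in> edges T - F" "u \<noteq> w" "u \<in> insert v0 (\<Union>F)"
    using exists_adjacent_edge v0 by blast
  let ?h = "(\<Sum>e\<in>F. edge_length T e) / 2" and ?k = "edge_length T {u, w}"
  have "edge_point u w 0 = indicator {u}" by (auto simp: edge_point_def indicator_def)
  moreover have "indicator {u} \<in> insert (indicator {v0}) (\<Union>e\<in>F. cell_points e)"
  proof (cases "u = v0")
    case False
    then obtain e where e: "e \<in> F" "u \<in> e" using uw(3) by auto
    then have "indicator {u} \<in> cell_points e"
      using F(1) by (intro indicator_in_cell finite_edge) auto
    then show ?thesis using e by blast
  qed simp
  ultimately have "edge_point u w 0 \<in> insert (indicator {v0}) (\<Union>e\<in>F. cell_points e)"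
    by simp
  then obtain d where d: "d \<le> ?h" "pl_path T c (edge_point u w 0) d" using c by blast
  obtain c' where c': "pl_path T c c' (?k / 2)"
    "\<And>y. y \<in> cell_points {u, w} \<Longrightarrow> \<exists>l\<le>?h + ?k / 2. pl_path T c' y l"
    using centre_extend[OF _ uw(2) d(2,1)] uw(1) by blast
  have sum: "(\<Sum>e\<in>insert {u, w} F. edge_length T e) / 2 = ?h + ?k / 2"
    using uw(1) finF by (simp add: add_divide_distrib)
  have reach: "\<exists>l\<le>(\<Sum>e\<in>insert {u, w} F. edge_length T e) / 2. pl_path T c' x l"
    if x: "x \<in> insert (indicator {v0}) (\<Union>e\<in>insert {u, w} F. cell_points e)" for x
  proof (cases "x \<in> cell_points {u, w}")
    case False
    then obtain l where "l \<le> ?h" "pl_path T c x l" using c[of x] x by auto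
    then have "pl_path T c' x (?k / 2 + l)" "?k / 2 + l \<le> ?h + ?k / 2"
      using pl_path_trans[OF pl_path_sym[OF c'(1)], of x l] by auto
    then show ?thesis unfolding sum by blast
  qed (unfold sum, rule c'(2))
  show ?case
  proof (intro exI[of _ "insert {u, w} F"] exI[of _ c'] conjI ballI)
    show "insert {u, w} F \<subseteq> edges T" "card (insert {u, w} F) = Suc n"
      using F uw(1) finF by auto
  qed (rule reach)
qed

lemma tree_points_eq_cells:
  assumes "edges T \<noteq> {}"
  shows "tree_points T = (\<Union>e\<in>edges T. cell_points e)"
proof -
  have "indicator {v} \<in> (\<Union>e\<in>edges T. cell_points e)" if v: "v \<in> nodes T" for v
  proof -
    have "{} \<subset> edges T" using assms by auto
    from exists_adjacent_edge[OF this v] obtain u w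
      where "{u, w} \<in> edges T - {}" "u \<in> insert v (\<Union>{})" by metis
    then have "{u, w} \<in> edges T" "u = v" by simp_all
    then have "indicator {v} \<in> cell_points {u, w}" by (intro indicator_in_cell) auto
    then show ?thesis using \<open>{u, w} \<in> edges T\<close> by blast
  qed
  then show ?thesis by (auto simp: tree_points_def cell_points_singleton)
qed

lemma edges_nonempty: "0 < total_length T \<Longrightarrow> edges T \<noteq> {}"
  by (auto simp: total_length_def)

lemma total_length_pos:
  assumes "nontrivial_tree T"
  shows "0 < total_length T"
proof -
  have "edges T \<noteq> {}"
  proof
    assume none: "edges T = {}"
    obtain v0 where v0: "v0 \<in> nodes T" using tree by (auto simp: finite_metric_tree_def)
    have "v \<in> {v0}" if "v \<in> nodes T" for v
    proof -
      have "(v0, v) \<in> {(a, b). {a, b} \<in> edges T}\<^sup>*"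
        using tree v0 that unfolding finite_metric_tree_def graph_connected_def by blast
      then show ?thesis by (induction rule: rtrancl_induct) (auto simp: none)
    qed
    then have "nodes T = {v0}" using v0 by blast
    then have "tree_points T = {indicator {v0}}"
      using none by (simp add: tree_points_def cell_points_singleton)
    then show False using assms by (auto simp: nontrivial_tree_def)
  qed
  then show ?thesis
    unfolding total_length_def using finite_edges edge_length_pos by (intro sum_pos) auto
qed

lemma exists_centre:
  assumes "0 < total_length T"
  obtains c where "c \<in> tree_points T"
    "\<And>x. x \<in> tree_points T \<Longrightarrow> \<exists>l\<le>total_length T / 2. pl_path T c x l"
proof -
  obtain v0 where v0: "v0 \<in> nodes T" using tree by (auto simp: finite_metric_tree_def)
  obtain F c where Fc: "F \<subseteq> edges T" "card F = card (edges T)"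
    "\<forall>x\<in>insert (indicator {v0}) (\<Union>e\<in>F. cell_points e).
      \<exists>l\<le>(\<Sum>e\<in>F. edge_length T e) / 2. pl_path T c x l"
    using exists_centre_of_part[OF v0 order.refl] by auto
  have F: "F = edges T" using Fc finite_edges card_subset_eq by blast
  have bound: "\<exists>l\<le>total_length T / 2. pl_path T c x l" if "x \<in> tree_points T" for x
    using that bspec[OF Fc(3), of x] tree_points_eq_cells[OF edges_nonempty[OF assms]]
    by (simp add: F total_length_def)
  have "\<exists>l\<le>(\<Sum>e\<in>F. edge_length T e) / 2. pl_path T c (indicator {v0}) l"
    using bspec[OF Fc(3) insertI1] .
  then have "c \<in> tree_points T" using pl_path_points by blast
  then show thesis using that bound by blast
qed

section \<open>The metric radius\<close>

lemma tree_dist_bounds: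
  assumes "0 < total_length T" "x \<in> tree_points T" "y \<in> tree_points T"
  shows "0 \<le> tree_dist T x y" "tree_dist T x y \<le> total_length T"
proof -
  obtain c where c: "\<And>x. x \<in> tree_points T \<Longrightarrow> \<exists>l\<le>total_length T / 2. pl_path T c x l"
    using exists_centre[OF assms(1)] by blast
  obtain l m where l: "l \<le> total_length T / 2" "pl_path T c x l"
    and m: "m \<le> total_length T / 2" "pl_path T c y m" using c assms by meson
  then have "pl_path T x y (l + m)" using pl_path_trans pl_path_sym by blast
  then show "0 \<le> tree_dist T x y" "tree_dist T x y \<le> total_length T"
    using tree_dist_nonneg tree_dist_le l m by force+
qed

lemma eccentricity_upper:
  assumes "0 < total_length T" "v \<in> tree_points T" "x \<in> tree_points T"
  shows "tree_dist T v x \<le> (SUP x\<in>tree_points T. tree_dist T v x)"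
  using assms tree_dist_bounds(2) by (intro cSUP_upper bdd_aboveI) auto

lemma eccentricity_nonneg:
  assumes "0 < total_length T" "v \<in> tree_points T"
  shows "0 \<le> (SUP x\<in>tree_points T. tree_dist T v x)"
  using eccentricity_upper[OF assms assms(2)] tree_dist_bounds(1)[OF assms assms(2)] by simp

lemma metric_radius_nonneg:
  assumes "0 < total_length T"
  shows "0 \<le> metric_radius T"
proof -
  have "tree_points T \<noteq> {}" using exists_centre[OF assms] by auto
  then show ?thesis
    unfolding metric_radius_def using eccentricity_nonneg[OF assms] by (rule cINF_greatest)
qed

lemma metric_radius_le_half:
  assumes "0 < total_length T"
  shows "metric_radius T \<le> total_length T / 2"
proof -
  obtain c where c: "c \<in> tree_points T"
    "\<And>x. x \<in> tree_points T \<Longrightarrow> \<exists>l\<le>total_length T / 2. pl_path T c x l"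
    using exists_centre[OF assms] by blast
  have "metric_radius T \<le> (SUP x\<in>tree_points T. tree_dist T c x)"
    unfolding metric_radius_def
    using eccentricity_nonneg[OF assms] c(1) by (intro cINF_lower bdd_belowI) auto
  also have "\<dots> \<le> total_length T / 2"
    using c tree_dist_le by (intro cSUP_least) force+
  finally show ?thesis .
qed

section \<open>Covers\<close>

text \<open>
  Covers are built from finite families of balls; enumerating the index set turns such a
  family into the list of radii that a cover consists of.
\<close>

lemma is_cover_of_family:
  fixes R :: "'i \<Rightarrow> real"
  assumes I: "finite I" "I \<noteq> {}"
    and R: "\<And>i. i \<in> I \<Longrightarrow> 0 \<le> R i"
    and v: "\<And>i. i \<in> I \<Longrightarrow> v i \<in> tree_points T"
    and cov: "\<And>x. x \<in> tree_points T \<Longrightarrow> \<exists>i\<in>I. tree_dist T x (v i) \<le> R i"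
  obtains rs where "is_cover T rs" "set rs = R ` I"
    "(\<Sum>j<length rs. rs ! j) = (\<Sum>i\<in>I. R i)"
proof -
  obtain g where g: "bij_betw g {..<card I} I"
    using ex_bij_betw_nat_finite[OF I(1)] by (auto simp: atLeast0LessThan)
  have gI: "g j \<in> I" if "j < card I" for j using g that by (auto simp: bij_betw_def)
  define rs where "rs = map (R \<circ> g) [0..<card I]"
  have nth: "rs ! j = R (g j)" if "j < card I" for j using that by (simp add: rs_def)
  have len: "length rs = card I" by (simp add: rs_def)
  have "is_cover T rs"
    unfolding is_cover_def
  proof (intro conjI exI[of _ "v \<circ> g"] allI impI subsetI)
    show "1 \<le> length rs" using I by (simp add: len card_gt_0_iff Suc_le_eq)
  next
    fix x assume x: "x \<in> tree_points T"
    then obtain i where i: "i \<in> I" "tree_dist T x (v i) \<le> R i" using cov by blast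
    moreover obtain j where "j < card I" "g j = i"
      using bij_betw_imp_surj_on[OF g] i(1) by (metis imageE lessThan_iff)
    ultimately show "x \<in> (\<Union>j<length rs. tree_ball T ((v \<circ> g) j) (rs ! j))"
      using x by (auto simp: tree_ball_def len nth)
  qed (use R v gI in \<open>auto simp: len nth\<close>)
  moreover have "set rs = R ` I"
    using bij_betw_imp_surj_on[OF g]
    by (metis rs_def set_map image_comp set_upt atLeast0LessThan)
  moreover have "(\<Sum>j<length rs. rs ! j) = (\<Sum>i\<in>I. R i)"
    using sum.reindex_bij_betw[OF g, of R] by (simp add: len nth)
  ultimately show thesis using that by blast
qed

lemma zero_good_cover_singleton:
  assumes "v \<in> tree_points T" "0 \<le> R" "R \<le> total_length T"
    and "\<And>x. x \<in> tree_points T \<Longrightarrow> tree_dist T x v \<le> R"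
  shows "zero_good_cover T [R]"
  using assms unfolding zero_good_cover_def is_cover_def
  by (auto simp: tree_ball_def intro!: exI[of _ "\<lambda>_. v"])

lemma zero_good_cover_half:
  assumes "0 < total_length T"
  shows "zero_good_cover T [total_length T / 2]"
proof -
  obtain c where c: "c \<in> tree_points T"
    "\<And>x. x \<in> tree_points T \<Longrightarrow> \<exists>l\<le>total_length T / 2. pl_path T c x l"
    using exists_centre[OF assms] by blast
  have "tree_dist T x c \<le> total_length T / 2" if "x \<in> tree_points T" for x
    using c(2)[OF that] tree_dist_le tree_dist_commute by force
  then show ?thesis using zero_good_cover_singleton c(1) assms by auto
qed

text \<open>
  The slack \<open>R - \<rho>\<close> replaces the fact that the minimum defining the metric radius is attained.
\<close>

lemma zero_good_cover_above_radius:
  assumes "0 < total_length T" "metric_radius T < R" "R \<le> total_length T"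
  shows "zero_good_cover T [R]"
proof -
  have "tree_points T \<noteq> {}" using exists_centre[OF assms(1)] by auto
  then obtain v where v: "v \<in> tree_points T" "(SUP x\<in>tree_points T. tree_dist T v x) < R"
    using assms(2) unfolding metric_radius_def
    by (meson cINF_greatest not_le)
  have "tree_dist T x v \<le> R" if "x \<in> tree_points T" for x
    using eccentricity_upper[OF assms(1) v(1) that] v(2) tree_dist_commute[of x v] by simp
  then show ?thesis
    using zero_good_cover_singleton v(1) assms metric_radius_nonneg by fastforce
qed

text \<open>
  Cutting every edge into equal pieces and centring a ball at the midpoint of each piece gives
  balls as small as desired, while the radii always add up to half of the total length.
\<close>

lemma exists_fine_cover:
  assumes L: "0 < total_length T" and \<epsilon>: "0 < \<epsilon>"
  obtains rs where "zero_good_cover T rs" "(\<Sum>i<length rs. rs ! i) = total_length T / 2"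
    "\<And>x. x \<in> set rs \<Longrightarrow> 0 < x \<and> x \<le> \<epsilon>"
proof -
  obtain n :: nat where n': "total_length T / (2 * \<epsilon>) < n" using reals_Archimedean2 by blast
  moreover have "0 < total_length T / (2 * \<epsilon>)" using L \<epsilon> by simp
  ultimately have "0 < real n" by (rule less_trans[rotated])
  then have n: "0 < n" "total_length T / (2 * \<epsilon>) \<le> n" using n' by simp_all
  have "\<forall>e\<in>edges T. \<exists>u w. {u, w} = e \<and> u \<noteq> w" using edge_card by (metis card_2_iff)
  then obtain a b where ab: "\<And>e. e \<in> edges T \<Longrightarrow> {a e, b e} = e"
    "\<And>e. e \<in> edges T \<Longrightarrow> a e \<noteq> b e" by metis
  define I where "I = edges T \<times> {..<n}"
  define R where "R = (\<lambda>(e, j::nat). edge_length T e / (2 * n))"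
  define v where "v = (\<lambda>(e, j::nat). edge_point (a e) (b e) ((2 * j + 1) / (2 * n)))"
  have I: "finite I" "I \<noteq> {}"
    using finite_edges edges_nonempty[OF L] n by (auto simp: I_def)
  have vI: "v i \<in> tree_points T" if i: "i \<in> I" for i
  proof -
    obtain e j where ej: "i = (e, j)" "e \<in> edges T" "j < n" using i by (auto simp: I_def)
    have "edge_point (a e) (b e) ((2 * j + 1) / (2 * n)) \<in> cell_points {a e, b e}"
      using ab(2) ej by (intro edge_point_in_cell) auto
    then show ?thesis using ab(1) ej cell_subset_tree_points by (auto simp: v_def)
  qed
  have Rpos: "0 < R i" if "i \<in> I" for i
    using that edge_length_pos n by (auto simp: I_def R_def)
  have cov: "\<exists>i\<in>I. tree_dist T x (v i) \<le> R i" if x: "x \<in> tree_points T" for x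
  proof -
    obtain e where e: "e \<in> edges T" "x \<in> cell_points e"
      using x tree_points_eq_cells[OF edges_nonempty[OF L]] by auto
    then obtain s where s: "0 \<le> s" "s \<le> 1" "x = edge_point (a e) (b e) s"
      using cell_points_eq_edge_point[OF ab(2)] ab(1) by metis
    \<comment> \<open>The end point \<open>s = 1\<close> belongs to the last piece, not to a piece of its own.\<close>
    define j where "j = (if s = 1 then n - 1 else nat \<lfloor>s * n\<rfloor>)"
    have j: "j < n" "j \<le> s * n" "s * n \<le> j + 1"
    proof -
      have "j < n \<and> j \<le> s * n \<and> s * n \<le> j + 1"
      proof (cases "s = 1")
        case True then show ?thesis using n by (auto simp: j_def of_nat_diff)
      next
        case False
        have "0 \<le> s * n" using s by simp
        then have "real j = of_int \<lfloor>s * n\<rfloor>" using False by (simp add: j_def)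
        then have "j \<le> s * n" "s * n \<le> j + 1" by linarith+
        moreover have "s * n < 1 * real n" using False s n by (intro mult_strict_right_mono) auto
        ultimately show ?thesis by simp
      qed
      then show "j < n" "j \<le> s * n" "s * n \<le> j + 1" by auto
    qed
    let ?m = "(2 * j + 1) / (2 * n)"
    have m01: "?m \<in> {0..1}" using j n by auto
    have "\<bar>s - ?m\<bar> \<le> 1 / (2 * n)"
    proof -
      have "s - ?m = (2 * (s * n) - (2 * j + 1)) / (2 * n)" using n by (simp add: field_simps)
      moreover have "\<bar>2 * (s * n) - (2 * j + 1)\<bar> \<le> 1" using j by linarith
      ultimately show ?thesis using n by (simp add: divide_right_mono)
    qed
    then have le: "edge_length T e * \<bar>s - ?m\<bar> \<le> R (e, j)"
      using edge_length_pos[OF e(1)] mult_left_mono[of _ _ "edge_length T e"]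
      by (fastforce simp: R_def)
    have "pl_path T x (v (e, j)) (edge_length T e * \<bar>s - ?m\<bar>)"
      using pl_path_edge_point[of "a e" "b e" s ?m] ab(1,2)[OF e(1)] e s m01 by (simp add: v_def)
    then have "tree_dist T x (v (e, j)) \<le> R (e, j)" using tree_dist_le le by fastforce
    then show ?thesis using e j by (auto simp: I_def)
  qed
  obtain rs where rs: "is_cover T rs" "set rs = R ` I"
    "(\<Sum>j<length rs. rs ! j) = (\<Sum>i\<in>I. R i)"
    using is_cover_of_family[OF I less_imp_le[OF Rpos] vI cov] .
  have "(\<Sum>i<length rs. rs ! i) = (\<Sum>i\<in>I. R i)" by (rule rs(3))
  also have "\<dots> = (\<Sum>e\<in>edges T. \<Sum>j<n. edge_length T e / (2 * n))"
    unfolding I_def R_def by (rule sum.cartesian_product[symmetric])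
  also have "\<dots> = total_length T / 2"
    using n by (simp add: total_length_def sum_divide_distrib)
  finally have sum: "(\<Sum>i<length rs. rs ! i) = total_length T / 2" .
  have small: "0 < x \<and> x \<le> \<epsilon>" if x: "x \<in> set rs" for x
  proof -
    obtain i where i: "i \<in> I" "x = R i" using x rs(2) by auto
    then obtain e where e: "e \<in> edges T" "x = edge_length T e / (2 * n)"
      by (auto simp: I_def R_def)
    have "edge_length T e \<le> total_length T"
      unfolding total_length_def using e finite_edges less_imp_le[OF edge_length_pos]
      by (intro member_le_sum) auto
    also have "\<dots> \<le> \<epsilon> * (2 * n)" using n \<epsilon> by (simp add: field_simps)
    finally have "x \<le> \<epsilon>" using e n by (simp add: divide_le_eq)
    then show ?thesis using Rpos i by auto
  qed
  show thesis using that[of rs] rs(1) sum small L by (auto simp: zero_good_cover_def)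
qed

end

section \<open>Power sums of the radii\<close>

lemma one_plus_le_two_powr:
  fixes p :: real
  assumes "1 \<le> p"
  shows "1 + p \<le> 2 powr p"
proof -
  \<comment> \<open>The weighted mean of \<open>1 + p\<close> and \<open>1\<close> with weights \<open>1 / p\<close> and \<open>1 - 1 / p\<close> is \<open>2\<close>.\<close>
  have "(1 + p) powr (1 / p) * 1 powr (1 - 1 / p) \<le> 1 / p * (1 + p) + (1 - 1 / p) * 1"
    using assms by (intro Youngs_inequality_0) auto
  also have "\<dots> = 2" using assms by (simp add: field_simps)
  finally have "((1 + p) powr (1 / p)) powr p \<le> 2 powr p"
    using assms by (intro powr_mono2) auto
  then show ?thesis using assms by (simp add: powr_powr)
qed

text \<open>
  For exponents at least one, fine covers are cheap: bounding all but one factor of each power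
  by the maximal radius \<open>r / 2\<close> gives \<open>(L / 2) (r / 2)\<^sup>p\<^sup>-\<^sup>1 = L r\<^sup>p\<^sup>-\<^sup>1 / 2\<^sup>p\<close>, and \<open>p + 1 \<le> 2\<^sup>p\<close>.
\<close>

lemma power_sum_ge_one:
  assumes T: "finite_metric_tree T" and L: "0 < total_length T"
    and r: "0 < r" and p: "1 \<le> p"
  shows "\<exists>rs. zero_good_cover T rs \<and>
    (\<Sum>i<length rs. (rs ! i) powr p) \<le> total_length T * r powr (p - 1) / (p + 1)"
proof -
  let ?L = "total_length T"
  obtain rs where rs: "zero_good_cover T rs" "(\<Sum>i<length rs. rs ! i) = ?L / 2"
    "\<And>x. x \<in> set rs \<Longrightarrow> 0 < x \<and> x \<le> r / 2"
    using exists_fine_cover[OF T L, of "r / 2"] r by auto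
  have le: "x powr p \<le> x * (r / 2) powr (p - 1)" if "x \<in> set rs" for x
  proof -
    have x: "0 < x" "x \<le> r / 2" using rs(3) that by auto
    have "x powr p = x * x powr (p - 1)" using x by (simp add: powr_diff)
    also have "\<dots> \<le> x * (r / 2) powr (p - 1)"
      using x p by (intro mult_left_mono powr_mono2) auto
    finally show ?thesis .
  qed
  have "(\<Sum>i<length rs. (rs ! i) powr p) \<le> (\<Sum>i<length rs. rs ! i * (r / 2) powr (p - 1))"
    using le by (intro sum_mono) auto
  also have "\<dots> = ?L / 2 * (r / 2) powr (p - 1)" using rs(2) by (simp flip: sum_distrib_right)
  also have "\<dots> = ?L * r powr (p - 1) / 2 powr p"
    using r by (simp add: powr_divide powr_diff)
  also have "\<dots> \<le> ?L * r powr (p - 1) / (p + 1)"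
    using one_plus_le_two_powr[OF p] L p by (intro divide_left_mono) (auto simp: add.commute)
  finally show ?thesis using rs(1) by blast
qed

text \<open>
  For exponents below one a single ball of radius \<open>R\<close> barely above \<open>\<rho>\<close> is cheap. The weighted
  inequality between the means gives \<open>R\<^sup>p \<le> r\<^sup>p\<^sup>-\<^sup>1 (p R + (1 - p) r)\<close>, and the bracket times \<open>1 + p\<close>
  is at most \<open>L\<close> because \<open>r \<le> L - \<rho>\<close> and \<open>\<rho> \<le> L / 2\<close>. With \<open>\<rho>\<close> in place of \<open>R\<close> the last bound
  is strict, since \<open>p\<close> lies strictly between zero and one; this leaves room for \<open>R > \<rho>\<close>.
\<close>

lemma power_sum_less_one:
  assumes T: "finite_metric_tree T" and L: "0 < total_length T"
    and r: "0 < r" "r \<le> total_length T - metric_radius T" and p: "0 < p" "p < 1"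
  shows "\<exists>rs. zero_good_cover T rs \<and>
    (\<Sum>i<length rs. (rs ! i) powr p) \<le> total_length T * r powr (p - 1) / (p + 1)"
proof -
  define L where "L = total_length T"
  define \<rho> where "\<rho> = metric_radius T"
  have \<rho>: "0 \<le> \<rho>" "\<rho> \<le> L / 2"
    using metric_radius_nonneg[OF T L] metric_radius_le_half[OF T L] by (auto simp: \<rho>_def L_def)
  have L0: "0 < L" using L by (simp add: L_def)
  \<comment> \<open>Chosen so that \<open>(1 + p) p \<epsilon>\<close> fits into the slack of the bound below, which is \<open>p\<^sup>2 L\<close> for
    \<open>p \<le> 1 / 2\<close> and \<open>(1 - p) L / 2\<close> otherwise.\<close>
  define \<epsilon> where "\<epsilon> = p * (1 - p) * L / 4"
  define R where "R = \<rho> + \<epsilon>"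
  have \<epsilon>: "0 < \<epsilon>" using p L0 by (simp add: \<epsilon>_def)
  have "p * (1 - p) \<le> 1 * 1" using p by (intro mult_mono) auto
  then have "p * (1 - p) * L \<le> 1 * L" using L0 by (intro mult_right_mono) auto
  then have "R \<le> L" using \<rho> by (simp add: R_def \<epsilon>_def)
  then have cover: "zero_good_cover T [R]"
    using zero_good_cover_above_radius[OF T L, of R] \<epsilon> by (simp add: R_def \<rho>_def L_def)
  have R0: "0 < R" using \<rho> \<epsilon> by (simp add: R_def)
  have "(1 + p) * (p * R + (1 - p) * r) \<le> (1 + p) * (p * R + (1 - p) * (L - \<rho>))"
    using p r by (intro mult_left_mono add_left_mono) (auto simp: L_def \<rho>_def)
  also have "\<dots> = (1 - p\<^sup>2) * L + (1 + p) * (2 * p - 1) * \<rho> + (1 + p) * p * \<epsilon>"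
    by (simp add: R_def power2_eq_square algebra_simps)
  also have "\<dots> \<le> L"
  proof (cases "2 * p \<le> 1")
    case True
    then have "(1 + p) * (2 * p - 1) * \<rho> \<le> 0"
      using p \<rho> by (intro mult_nonpos_nonneg mult_nonneg_nonpos) auto
    moreover have "(1 + p) * p * \<epsilon> \<le> p\<^sup>2 * L"
    proof -
      have "(1 + p) * (1 - p) \<le> 4" using p by (simp add: algebra_simps)
      then have "p\<^sup>2 * L / 4 * ((1 + p) * (1 - p)) \<le> p\<^sup>2 * L / 4 * 4"
        using L0 by (intro mult_left_mono) auto
      then show ?thesis by (simp add: \<epsilon>_def power2_eq_square algebra_simps)
    qed
    ultimately show ?thesis by (simp add: algebra_simps)
  next
    case False
    then have "(1 + p) * (2 * p - 1) * \<rho> \<le> (1 + p) * (2 * p - 1) * (L / 2)"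
      using p \<rho> by (intro mult_left_mono) auto
    moreover have "(1 + p) * p * \<epsilon> \<le> (1 - p) * L / 2"
    proof -
      have "(1 + p) * (p * p) \<le> 2 * (1 * 1)" using p by (intro mult_mono) auto
      then have "(1 - p) * L / 4 * ((1 + p) * (p * p)) \<le> (1 - p) * L / 4 * 2"
        using L0 p by (intro mult_left_mono) auto
      moreover have "(1 - p) * L / 4 * ((1 + p) * (p * p)) = (1 + p) * p * \<epsilon>"
        by (simp add: \<epsilon>_def)
      moreover have "(1 - p) * L / 4 * 2 = (1 - p) * L / 2" by simp
      ultimately show ?thesis by linarith
    qed
    moreover have "(1 - p\<^sup>2) * L + (1 + p) * (2 * p - 1) * (L / 2) + (1 - p) * L / 2 = L"
      by (simp add: power2_eq_square field_simps)
    ultimately show ?thesis by linarith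
  qed
  finally have bracket: "p * R + (1 - p) * r \<le> L / (p + 1)"
    using p by (simp add: pos_le_divide_eq mult.commute add.commute)
  have "R powr p = R powr p * r powr (1 - p) * r powr (p - 1)"
    using r by (simp add: mult.assoc flip: powr_add)
  also have "\<dots> \<le> L / (p + 1) * r powr (p - 1)"
  proof (rule mult_right_mono)
    have "R powr p * r powr (1 - p) \<le> p * R + (1 - p) * r"
      using p R0 r by (intro Youngs_inequality_0) auto
    then show "R powr p * r powr (1 - p) \<le> L / (p + 1)" using bracket by simp
  qed simp
  finally show ?thesis using cover by (intro exI[of _ "[R]"]) (simp add: L_def)
qed

theorem corollary5p10:
  fixes T :: "'a weighted_graph" and L \<rho> r :: real
  assumes "finite_metric_tree T"
    and "nontrivial_tree T"
    and "L = total_length T"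
    and "\<rho> = metric_radius T"
    and "0 < r" and "r \<le> L - \<rho>"
  shows "(\<exists>rs. zero_good_cover T rs \<and> int (length rs) \<le> \<lfloor>L / r\<rfloor>) \<and>
    (\<forall>p::real. 0 < p \<longrightarrow>
       (\<exists>rs. zero_good_cover T rs \<and>
          (\<Sum>i<length rs. (rs ! i) powr p) \<le> L * r powr (p - 1) / (p + 1))) \<and>
    (\<exists>rs. zero_good_cover T rs \<and> (\<Sum>i<length rs. rs ! i) \<le> L / 2) \<and>
    (\<forall>t::real. 0 \<le> t \<and> t \<le> r \<longrightarrow>
       (\<exists>rs. zero_good_cover T rs \<and>
          int (card {i. i < length rs \<and> t \<le> rs ! i}) \<le> \<lfloor>L * (r - t) / r\<^sup>2\<rfloor>))"
proof -
  note T = assms(1)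
  have L: "0 < total_length T" using total_length_pos[OF T assms(2)] .
  have L0: "0 < L" and r: "0 < r" "r \<le> total_length T - metric_radius T"
    using L assms by auto
  have "r \<le> L" using r metric_radius_nonneg[OF T L] assms(3) by simp
  then have one: "1 \<le> \<lfloor>L / r\<rfloor>" using r by simp
  have half: "zero_good_cover T [L / 2]" using zero_good_cover_half[OF T L] assms(3) by simp
  have count: "\<exists>rs. zero_good_cover T rs \<and> int (length rs) \<le> \<lfloor>L / r\<rfloor>"
    using half one by (intro exI[of _ "[L / 2]"]) simp
  moreover have "\<exists>rs. zero_good_cover T rs \<and>
      (\<Sum>i<length rs. (rs ! i) powr p) \<le> L * r powr (p - 1) / (p + 1)" if "0 < p" for p
    using power_sum_ge_one[OF T L r(1), of p] power_sum_less_one[OF T L r that] that assms(3)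
    by (cases "1 \<le> p") auto
  moreover have "\<exists>rs. zero_good_cover T rs \<and> (\<Sum>i<length rs. rs ! i) \<le> L / 2"
    using half by (intro exI[of _ "[L / 2]"]) simp
  moreover have "\<exists>rs. zero_good_cover T rs \<and>
      int (card {i. i < length rs \<and> t \<le> rs ! i}) \<le> \<lfloor>L * (r - t) / r\<^sup>2\<rfloor>"
    if t: "0 \<le> t" "t \<le> r" for t
  proof (cases "t = 0")
    case True
    obtain rs where rs: "zero_good_cover T rs" "int (length rs) \<le> \<lfloor>L / r\<rfloor>" using count by blast
    have "card {i. i < length rs \<and> t \<le> rs ! i} \<le> card {..<length rs}"
      by (intro card_mono) auto
    moreover have "L * (r - t) / r\<^sup>2 = L / r" using True r by (simp add: power2_eq_square)
    ultimately show ?thesis using rs by (intro exI[of _ rs]) auto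
  next
    case False
    then have "0 < t / 2" using t by simp
    from exists_fine_cover[OF T L this] obtain rs where rs: "zero_good_cover T rs"
      "\<And>x. x \<in> set rs \<Longrightarrow> 0 < x \<and> x \<le> t / 2" by metis
    have none: "{i. i < length rs \<and> t \<le> rs ! i} = {}"
      using rs(2)[OF nth_mem] \<open>0 < t / 2\<close> by force
    have "0 \<le> L * (r - t) / r\<^sup>2" using L0 t by simp
    then show ?thesis using rs(1) by (intro exI[of _ rs]) (simp only: none, simp)
  qed
  ultimately show ?thesis by blast
qed

end
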